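(* Let $k$ be a field and $K$ a field extension of $k$. The following are equivalent: (1) $K$ is special (as a $k$-algebra); (2) $K$ preserves the algebraic signature of $k$, i.e. $D(\bar a)\neq 0$ for every $D\in\mathcal D$ and every appropriate tuple $\bar a$ from $K$; (3) $K$ is a $*$-algebra over $k$.
   Context: The algebraic signature $\mathcal D$ of $k$ is the set of all polynomials in finitely many variables over $k$ which have no zero rational in $k$. The homogeneous signature $\mathcal H$ of $k$ is the set of all non-zero homogeneous polynomials $P(\bar X,Y)$ over $k$ in finitely many variables $\bar X=(X_1,\ldots,X_n)$ and a distinguished variable $Y$ such that for all $\bar a\in k^n$ and $b\in k$, $P(\bar a,b)=0$ implies $b=0$. A (commutative, unital) $k$-algebra $A$ is special if for all $P(\bar X,Y)\in\mathcal H$ and all $\bar a,b$ from $A$ with $P(\bar a,b)=0$, we have $b=0$. A $k$-algebra $A$ is a $*$-algebra if $D(\bar a)$ is invertible in $A$ for all $D\in\mathcal D$ and all appropriate tuples $\bar a$ from $A$. *)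

theory Defs
  imports
    "HOL-Library.Poly_Mapping"
    "Jordan_Normal_Form.Matrix"
begin

text \<open>
  A monomial is a finitely supported exponent function, and a polynomial a finitely supported
  coefficient function on monomials, so every polynomial involves only finitely many of the
  variables indexed by \<open>nat\<close>.
\<close>

type_synonym 'k mpoly = "(nat \<Rightarrow>\<^sub>0 nat) \<Rightarrow>\<^sub>0 'k"

text \<open>
  A \<open>k\<close>-algebra \<open>A\<close> is given by its structure map \<open>h :: k \<Rightarrow> A\<close>, a ring homomorphism
  (locale \<open>comm_ring_hom\<close>; \<open>field_hom\<close> for a field extension).
  Tuples from \<open>A\<close> are given as total assignments; by \<open>eval_cong\<close> below only the values at the
  finitely many variables that occur matter.
\<close>

definition eval :: "('k::zero \<Rightarrow> 'a::comm_ring_1) \<Rightarrow> 'k mpoly \<Rightarrow> (nat \<Rightarrow> 'a) \<Rightarrow> 'a" where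
  "eval h P a =
     (\<Sum>m \<in> Poly_Mapping.keys P.
        h (Poly_Mapping.lookup P m) *
        (\<Prod>i \<in> Poly_Mapping.keys m. a i ^ Poly_Mapping.lookup m i))"

definition vars :: "'k::zero mpoly \<Rightarrow> nat set" where
  "vars P = (\<Union>m \<in> Poly_Mapping.keys P. Poly_Mapping.keys m)"

lemma finite_vars: "finite (vars P)"
  by (simp add: vars_def)

lemma eval_cong:
  assumes "\<And>i. i \<in> vars P \<Longrightarrow> a i = b i"
  shows "eval h P a = eval h P b"
proof -
  have "a i ^ Poly_Mapping.lookup m i = b i ^ Poly_Mapping.lookup m i"
    if "m \<in> Poly_Mapping.keys P" "i \<in> Poly_Mapping.keys m" for m i
  proof -
    from that have "i \<in> vars P"
      by (auto simp: vars_def)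
    then show ?thesis
      by (simp add: assms)
  qed
  then show ?thesis
    by (simp add: eval_def cong: sum.cong prod.cong)
qed

definition homogeneous :: "'k::zero mpoly \<Rightarrow> bool" where
  "homogeneous P \<longleftrightarrow>
     (\<exists>d. \<forall>m \<in> Poly_Mapping.keys P. (\<Sum>i \<in> Poly_Mapping.keys m. Poly_Mapping.lookup m i) = d)"

definition algebraic_signature :: "'k::field mpoly set" where
  "algebraic_signature = {D. \<forall>a :: nat \<Rightarrow> 'k. eval id D a \<noteq> 0}"

text \<open>
  In the homogeneous signature, variable \<open>0\<close> is the distinguished variable \<open>Y\<close> and variable
  \<open>Suc i\<close> is the \<open>i\<close>-th of the variables \<open>X\<close>; accordingly \<open>case_nat b a\<close> is the assignment
  substituting \<open>b\<close> for \<open>Y\<close> and the tuple \<open>a\<close> for the variables \<open>X\<close>.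
\<close>

definition homogeneous_signature :: "'k::field mpoly set" where
  "homogeneous_signature =
     {P. P \<noteq> 0 \<and> homogeneous P \<and>
         (\<forall>(a :: nat \<Rightarrow> 'k) b. eval id P (case_nat b a) = 0 \<longrightarrow> b = 0)}"

definition special :: "('k::field \<Rightarrow> 'a::comm_ring_1) \<Rightarrow> bool" where
  "special h \<longleftrightarrow>
     (\<forall>P \<in> homogeneous_signature. \<forall>(a :: nat \<Rightarrow> 'a) b.
        eval h P (case_nat b a) = 0 \<longrightarrow> b = 0)"

definition star_algebra :: "('k::field \<Rightarrow> 'a::comm_ring_1) \<Rightarrow> bool" where
  "star_algebra h \<longleftrightarrow>
     (\<forall>D \<in> algebraic_signature. \<forall>a :: nat \<Rightarrow> 'a. eval h D a dvd 1)"

definition preserves_algebraic_signature :: "('k::field \<Rightarrow> 'a::comm_ring_1) \<Rightarrow> bool" where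
  "preserves_algebraic_signature h \<longleftrightarrow>
     (\<forall>D \<in> algebraic_signature. \<forall>a :: nat \<Rightarrow> 'a. eval h D a \<noteq> 0)"

end

theory Submission
  imports Defs
begin

text \<open>
  Away from \<open>Y = 0\<close>, the zeros of a homogeneous polynomial correspond, by scaling, to the zeros of
  its dehomogenization at \<open>Y = 1\<close>. Over \<open>k\<close> this shows that
  dehomogenization maps the homogeneous signature into the algebraic one and that homogenization
  maps back; over the extension it turns a violation of one signature into one of the other.
\<close>

section \<open>Scaling of monomials and of homogeneous polynomials\<close>

abbreviation monom_degree :: "(nat \<Rightarrow>\<^sub>0 nat) \<Rightarrow> nat" where
  "monom_degree m \<equiv> \<Sum>i \<in> Poly_Mapping.keys m. Poly_Mapping.lookup m i"

abbreviation monom_eval :: "(nat \<Rightarrow>\<^sub>0 nat) \<Rightarrow> (nat \<Rightarrow> 'a::comm_ring_1) \<Rightarrow> 'a" where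
  "monom_eval m a \<equiv> \<Prod>i \<in> Poly_Mapping.keys m. a i ^ Poly_Mapping.lookup m i"

text \<open>The support of a monomial may be known only up to inclusion: \<open>cons_monom\<close>
  below has 0 in its support only for a positive exponent of \<open>Y\<close>. Surplus indices have
  exponent 0 and contribute nothing.\<close>

lemma monom_degree_superset:
  assumes "finite S" "Poly_Mapping.keys m \<subseteq> S"
  shows "monom_degree m = (\<Sum>i\<in>S. Poly_Mapping.lookup m i)"
  using assms by (intro sum.mono_neutral_left) (auto simp: in_keys_iff)

lemma monom_eval_superset:
  assumes "finite S" "Poly_Mapping.keys m \<subseteq> S"
  shows "monom_eval m a = (\<Prod>i\<in>S. a i ^ Poly_Mapping.lookup m i)"
  using assms by (intro prod.mono_neutral_left) (auto simp: in_keys_iff)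

lemma monom_eval_scale: "monom_eval m (\<lambda>i. c * a i) = c ^ monom_degree m * monom_eval m a"
  by (simp add: power_mult_distrib prod.distrib power_sum)

lemma eval_scale:
  assumes "\<And>m. m \<in> Poly_Mapping.keys P \<Longrightarrow> monom_degree m = d"
  shows "eval h P (\<lambda>i. c * a i) = c ^ d * eval h P a"
  unfolding eval_def monom_eval_scale sum_distrib_left
  by (intro sum.cong) (simp_all add: assms mult_ac)

lemma eval_homogeneous_scale:
  fixes h :: "'k::zero \<Rightarrow> 'a::field"
  assumes "\<And>m. m \<in> Poly_Mapping.keys P \<Longrightarrow> monom_degree m = d" and "b \<noteq> 0"
  shows "eval h P (case_nat b a) = b ^ d * eval h P (case_nat 1 (\<lambda>i. a i / b))"
proof -
  \<comment> \<open>Dividing the whole tuple by its \<open>Y\<close>-coordinate moves the point to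
    \<open>Y = 1\<close>; the common factor \<open>b\<close> then leaves as
    \<open>b ^ d\<close>.\<close>
  have "case_nat b a = (\<lambda>i. b * case_nat 1 (\<lambda>i. a i / b) i)"
    using \<open>b \<noteq> 0\<close> by (auto split: nat.split)
  then show ?thesis
    using eval_scale[OF assms(1)] by simp
qed

section \<open>Additivity of evaluation and maps on monomials\<close>

lemma eval_superset:
  assumes "h 0 = 0" "finite S" "Poly_Mapping.keys P \<subseteq> S"
  shows "eval h P a = (\<Sum>m\<in>S. h (Poly_Mapping.lookup P m) * monom_eval m a)"
  unfolding eval_def
  using assms by (intro sum.mono_neutral_left) (auto simp: in_keys_iff)

lemma eval_zero: "eval h 0 a = 0"
  by (simp add: eval_def)

lemma eval_single:
  assumes "h 0 = 0"
  shows "eval h (Poly_Mapping.single m c) a = h c * monom_eval m a"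
  using eval_superset[of h "{m}" "Poly_Mapping.single m c" a] assms by simp

lemma eval_add:
  fixes P Q :: "'k::comm_monoid_add mpoly"
  assumes "h 0 = 0" "\<And>x y. h (x + y) = h x + h y"
  shows "eval h (P + Q) a = eval h P a + eval h Q a"
proof -
  \<comment> \<open>Coefficients may cancel in \<open>P + Q\<close>, so all three evaluations are
    spread over one common set of monomials.\<close>
  define S where "S = Poly_Mapping.keys P \<union> Poly_Mapping.keys Q"
  have "finite S" "Poly_Mapping.keys P \<subseteq> S" "Poly_Mapping.keys Q \<subseteq> S"
    "Poly_Mapping.keys (P + Q) \<subseteq> S"
    using Poly_Mapping.keys_add[of P Q] by (auto simp: S_def)
  then show ?thesis
    using assms
    by (simp add: eval_superset[of h S] lookup_add distrib_right sum.distrib)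
qed

lemma eval_sum:
  fixes P :: "'i \<Rightarrow> 'k::comm_monoid_add mpoly"
  assumes "h 0 = 0" "\<And>x y. h (x + y) = h x + h y"
  shows "eval h (sum P I) a = (\<Sum>i\<in>I. eval h (P i) a)"
  by (induction I rule: infinite_finite_induct) (simp_all add: eval_zero eval_add assms)

text \<open>As a sum of single terms, this adds up the coefficients of monomials with the same
  image, so \<open>f\<close> need not be injective, and evaluation can be computed term by
  term.\<close>

definition map_monom ::
  "((nat \<Rightarrow>\<^sub>0 nat) \<Rightarrow> (nat \<Rightarrow>\<^sub>0 nat)) \<Rightarrow> 'k::comm_monoid_add mpoly \<Rightarrow> 'k mpoly" where
  "map_monom f P =
     (\<Sum>m \<in> Poly_Mapping.keys P. Poly_Mapping.single (f m) (Poly_Mapping.lookup P m))"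

lemma keys_map_monom: "Poly_Mapping.keys (map_monom f P) \<subseteq> f ` Poly_Mapping.keys P"
  unfolding map_monom_def
  by (rule order_trans[OF Poly_Mapping.keys_sum]) (auto split: if_splits)

lemma eval_map_monom:
  fixes P :: "'k::comm_monoid_add mpoly"
  assumes "h 0 = 0" "\<And>x y. h (x + y) = h x + h y"
    and "\<And>m. m \<in> Poly_Mapping.keys P \<Longrightarrow> monom_eval (f m) a = monom_eval m b"
  shows "eval h (map_monom f P) a = eval h P b"
proof -
  have "eval h (map_monom f P) a
      = (\<Sum>m\<in>Poly_Mapping.keys P. h (Poly_Mapping.lookup P m) * monom_eval (f m) a)"
    by (simp add: map_monom_def eval_sum eval_single assms(1,2))
  also have "\<dots> = eval h P b"
    unfolding eval_def by (intro sum.cong) (simp_all add: assms(3))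
  finally show ?thesis .
qed

section \<open>Shifting monomials to make room for \<open>Y\<close>\<close>

definition cons_monom :: "nat \<Rightarrow> (nat \<Rightarrow>\<^sub>0 nat) \<Rightarrow> (nat \<Rightarrow>\<^sub>0 nat)" where
  "cons_monom e m = Abs_poly_mapping (case_nat e (Poly_Mapping.lookup m))"

lemma lookup_cons_monom:
  "Poly_Mapping.lookup (cons_monom e m) = case_nat e (Poly_Mapping.lookup m)"
proof -
  \<comment> \<open>\<open>Abs_poly_mapping\<close> is meaningful only on finitely supported
    functions.\<close>
  have "{i. case_nat e (Poly_Mapping.lookup m) i \<noteq> 0} \<subseteq> insert 0 (Suc ` Poly_Mapping.keys m)"
  proof
    fix i
    assume "i \<in> {i. case_nat e (Poly_Mapping.lookup m) i \<noteq> 0}"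
    then show "i \<in> insert 0 (Suc ` Poly_Mapping.keys m)"
      by (cases i) (auto simp: in_keys_iff)
  qed
  then have "finite {i. case_nat e (Poly_Mapping.lookup m) i \<noteq> 0}"
    by (rule finite_subset) simp
  then show ?thesis
    unfolding cons_monom_def by (rule lookup_Abs_poly_mapping)
qed

lemma keys_cons_monom:
  "Poly_Mapping.keys (cons_monom e m) \<subseteq> insert 0 (Suc ` Poly_Mapping.keys m)"
proof
  fix i
  assume "i \<in> Poly_Mapping.keys (cons_monom e m)"
  then show "i \<in> insert 0 (Suc ` Poly_Mapping.keys m)"
    by (cases i) (auto simp: in_keys_iff lookup_cons_monom)
qed

lemma monom_degree_cons: "monom_degree (cons_monom e m) = e + monom_degree m"
  by (subst monom_degree_superset[OF _ keys_cons_monom])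
    (simp_all add: lookup_cons_monom sum.reindex)

lemma monom_eval_cons: "monom_eval (cons_monom e m) (case_nat b a) = b ^ e * monom_eval m a"
  by (subst monom_eval_superset[OF _ keys_cons_monom])
    (simp_all add: lookup_cons_monom prod.reindex)

text \<open>\<open>map_key Suc\<close> drops the exponent of \<open>Y\<close> and renumbers the
  variables \<open>X\<close> from 0. Restoring that exponent shows that every monomial is of the
  form \<open>cons_monom e n\<close>, so the evaluation rule for \<open>cons_monom\<close> covers
  all monomials.\<close>

lemma cons_monom_map_key:
  "cons_monom (Poly_Mapping.lookup m 0) (Poly_Mapping.map_key Suc m) = m"
  by (rule poly_mapping_eqI) (simp add: lookup_cons_monom map_key.rep_eq split: nat.split)

section \<open>Dehomogenization and homogenization\<close>

definition dehomogenize :: "'k::comm_monoid_add mpoly \<Rightarrow> 'k mpoly" where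
  "dehomogenize = map_monom (Poly_Mapping.map_key Suc)"

lemma eval_dehomogenize:
  fixes P :: "'k::comm_monoid_add mpoly"
  assumes "h 0 = 0" "\<And>x y. h (x + y) = h x + h y"
  shows "eval h (dehomogenize P) a = eval h P (case_nat 1 a)"
  unfolding dehomogenize_def
proof (rule eval_map_monom[OF assms])
  fix m
  show "monom_eval (Poly_Mapping.map_key Suc m) a = monom_eval m (case_nat 1 a)"
    \<comment> \<open>With \<open>b = 1\<close> the split-off power of \<open>Y\<close> becomes
      1.\<close>
    using monom_eval_cons[where e = "Poly_Mapping.lookup m 0" and m = "Poly_Mapping.map_key Suc m"
        and b = 1 and a = a]
    by (simp add: cons_monom_map_key)
qed

text \<open>Monomials are padded with powers of \<open>Y\<close> up to degree \<open>d\<close>.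
  Subtraction is truncated, so a monomial of degree above \<open>d\<close> gets no \<open>Y\<close>;
  homogeneity is therefore claimed only under a degree bound.\<close>

definition homogenize :: "nat \<Rightarrow> 'k::comm_monoid_add mpoly \<Rightarrow> 'k mpoly" where
  "homogenize d = map_monom (\<lambda>m. cons_monom (d - monom_degree m) m)"

text \<open>The padding evaluates to a power of 1, whatever its exponent.\<close>

lemma eval_homogenize:
  fixes P :: "'k::comm_monoid_add mpoly"
  assumes "h 0 = 0" "\<And>x y. h (x + y) = h x + h y"
  shows "eval h (homogenize d P) (case_nat 1 a) = eval h P a"
  unfolding homogenize_def by (rule eval_map_monom[OF assms]) (simp add: monom_eval_cons)

lemma monom_degree_homogenize:
  assumes "\<And>m. m \<in> Poly_Mapping.keys P \<Longrightarrow> monom_degree m \<le> d"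
    and "m \<in> Poly_Mapping.keys (homogenize d P)"
  shows "monom_degree m = d"
proof -
  obtain n where "n \<in> Poly_Mapping.keys P" "m = cons_monom (d - monom_degree n) n"
    using subsetD[OF keys_map_monom assms(2)[unfolded homogenize_def]] by (elim imageE)
  then show ?thesis
    using assms(1) by (simp add: monom_degree_cons)
qed

section \<open>Correspondence of the two signatures over \<open>k\<close>\<close>

lemma dehomogenize_algebraic_signature:
  fixes P :: "'k::field mpoly"
  assumes "P \<in> homogeneous_signature"
  shows "dehomogenize P \<in> algebraic_signature"
proof -
  have "eval id P (case_nat 1 a) \<noteq> 0" for a
  proof
    assume "eval id P (case_nat 1 a) = 0"
    with assms have "(1::'k) = 0"
      unfolding homogeneous_signature_def by blast
    then show False
      by simp
  qed
  then show ?thesis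
    by (simp add: algebraic_signature_def eval_dehomogenize)
qed

text \<open>At \<open>Y = 1\<close> the homogenization takes the values of \<open>D\<close>, which
  never vanish; scaling by \<open>b\<close> carries this to every \<open>b \<noteq> 0\<close>. A
  non-zero value also shows that the polynomial is not 0.\<close>

lemma homogenize_homogeneous_signature:
  assumes "D \<in> algebraic_signature"
    and "\<And>m. m \<in> Poly_Mapping.keys D \<Longrightarrow> monom_degree m \<le> d"
  shows "homogenize d D \<in> homogeneous_signature"
proof -
  have nz: "eval id (homogenize d D) (case_nat 1 a) \<noteq> 0" for a
    using assms(1) by (simp add: eval_homogenize algebraic_signature_def)
  note deg = monom_degree_homogenize[OF assms(2)]
  have "homogenize d D \<noteq> 0"
    using nz by (metis eval_zero)
  moreover have "homogeneous (homogenize d D)"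
    using deg unfolding homogeneous_def by blast
  moreover have "eval id (homogenize d D) (case_nat b a) \<noteq> 0" if "b \<noteq> 0" for a b
    using nz that by (subst eval_homogeneous_scale[OF deg]) simp_all
  ultimately show ?thesis
    by (auto simp: homogeneous_signature_def)
qed

section \<open>Transfer of violations over the extension\<close>

lemma special_if_preserves_algebraic_signature:
  fixes h :: "'k::field \<Rightarrow> 'l::field"
  assumes "h 0 = 0" "\<And>x y. h (x + y) = h x + h y"
    and "preserves_algebraic_signature h"
  shows "special h"
  unfolding special_def
proof (intro ballI allI impI, rule ccontr)
  fix P :: "'k mpoly" and a :: "nat \<Rightarrow> 'l" and b
  assume P: "P \<in> homogeneous_signature" and zero: "eval h P (case_nat b a) = 0" and "b \<noteq> 0"
  from P obtain d where "\<forall>m \<in> Poly_Mapping.keys P. monom_degree m = d"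
    unfolding homogeneous_signature_def homogeneous_def by blast
  \<comment> \<open>Here \<open>b\<close> is inverted, which is why the target is a field. The
    violation moves to \<open>Y = 1\<close>, where it becomes a zero of the
    dehomogenization.\<close>
  then have "eval h P (case_nat b a) = b ^ d * eval h P (case_nat 1 (\<lambda>i. a i / b))"
    using \<open>b \<noteq> 0\<close> by (intro eval_homogeneous_scale) (rule bspec)
  then have "eval h P (case_nat 1 (\<lambda>i. a i / b)) = 0"
    using zero \<open>b \<noteq> 0\<close> by simp
  then have "eval h (dehomogenize P) (\<lambda>i. a i / b) = 0"
    by (simp add: eval_dehomogenize assms(1,2))
  then show False
    using assms(3) dehomogenize_algebraic_signature[OF P]
    by (auto simp: preserves_algebraic_signature_def)
qed

text \<open>A zero of \<open>D\<close> is a zero of its homogenization with \<open>Y = 1\<close>,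
  and \<open>1 \<noteq> 0\<close>. Nothing is divided, so the target may be any commutative ring
  with \<open>1 \<noteq> 0\<close>.\<close>

lemma preserves_algebraic_signature_if_special:
  fixes h :: "'k::field \<Rightarrow> 'a::comm_ring_1"
  assumes "h 0 = 0" "\<And>x y. h (x + y) = h x + h y"
    and "special h"
  shows "preserves_algebraic_signature h"
  unfolding preserves_algebraic_signature_def
proof (intro ballI allI notI)
  fix D :: "'k mpoly" and a :: "nat \<Rightarrow> 'a"
  assume D: "D \<in> algebraic_signature" and zero: "eval h D a = 0"
  \<comment> \<open>The total degree of \<open>D\<close>, large enough for the padding exponents to
    be exact differences.\<close>
  define d where "d = Max (monom_degree ` Poly_Mapping.keys D)"
  have "homogenize d D \<in> homogeneous_signature"
    using D by (rule homogenize_homogeneous_signature) (simp add: d_def)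
  moreover have "eval h (homogenize d D) (case_nat 1 a) = 0"
    using zero by (simp add: eval_homogenize assms(1,2))
  ultimately have "(1::'a) = 0"
    using assms(3) unfolding special_def by blast
  then show False
    by simp
qed

theorem proposition4p12:
  fixes h :: "'k::field \<Rightarrow> 'l::field"
  assumes "field_hom h"
  shows "(special h \<longleftrightarrow> preserves_algebraic_signature h) \<and>
         (preserves_algebraic_signature h \<longleftrightarrow> star_algebra h)"
proof
  interpret field_hom h by (fact assms)
  show "special h \<longleftrightarrow> preserves_algebraic_signature h"
    using special_if_preserves_algebraic_signature[of h]
      preserves_algebraic_signature_if_special[of h]
    by (auto simp: hom_add)
  \<comment> \<open>In a field, the divisors of 1 are exactly the non-zero elements.\<close>
  show "preserves_algebraic_signature h \<longleftrightarrow> star_algebra h"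
    by (simp add: preserves_algebraic_signature_def star_algebra_def dvd_field_iff)
qed

end
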